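(* Let $h$ and $F$ be as in the context, and suppose: $\nabla F$ is $L_{\nabla F}$-Lipschitz; $h$ is $(\alpha,\beta)$-regular (smooth sense) for $F$ with unique minimizer $z^\star$ over $\operatorname{Im}F$; and $F$ is strongly aligned at $z^\star$ with function $\delta$ and constant $s>0$. Let $x_0\in\mathbf{E}$ be such that $z_0=F(x_0)$ satisfies $\|z_0-z^\star\|\le \delta\left(\frac{\alpha}{16\beta}\right)$. Then the following two statements hold. 1. (Polyak stepsize) Suppose $(x_k)_{k\ge0}$ is generated by the LMM method started at $x_0$ with the Polyak configuration with parameters $\gamma, C_{\mathtt{lb}}, C_{\mathtt{ub}}$, where $\gamma\le\min\left\{1,\frac{C_{\mathtt{lb}}}{L_{\nabla F}}\right\}$, and suppose additionally that $\|z_0-z^\star\|\le\frac{s\alpha}{16C_{\mathtt{ub}}\beta}$. Then $z_k=F(x_k)$ satisfies $$\|z_k-z^\star\|^2\le\left(1-\frac{\gamma\alpha}{32\beta}\right)^{k}\|z_0-z^\star\|^2\quad\text{for all }k\ge0.$$ 2. (Constant stepsize) Let $M=\delta\left(\frac{\alpha}{16\beta}\right)$. Suppose $(x_k)_{k\ge0}$ is generated by the LMM method started at $x_0$ with $\gamma_k=\gamma$, $\lambda_k=\lambda q^k$, where $\gamma,\lambda>0$, $q\in(0,1)$ satisfy $$\lambda\le\frac{s\alpha}{16\beta},\qquad \gamma\le\frac1\beta\min\left\{\frac18,\sqrt{\frac{32\lambda}{L_{\nabla F}M}},\frac{\lambda}{2L_{\nabla F}M}\right\},\qquad q\ge\max\left\{\sqrt{1-\frac{\gamma\alpha}{2}},\frac1{\sqrt2}\right\}.$$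 Then $z_k=F(x_k)$ satisfies $\|z_k-z^\star\|\le Mq^k$ for all $k\ge0$.
   Context: Setting. $\mathbf{E},\mathbf{Y}$ are finite-dimensional Euclidean spaces with inner products $\langle\cdot,\cdot\rangle$ and induced norms $\|\cdot\|$; $h:\mathbf{Y}\to\mathbb{R}$ is convex and differentiable, and $F:\mathbf{E}\to\mathbf{Y}$ is continuously differentiable. $\nabla F(x):\mathbf{E}\to\mathbf{Y}$ is the derivative (Jacobian) and $\nabla F(x)^\top$ its adjoint. $\mathbb{R}_+$ denotes the positive reals, $B_r(z)$ the closed ball of radius $r$, and $1/0=+\infty$. $h^\star$ and $\mathcal{Z}^\star$ are the minimum value and the set of minimizers of $h$ over $\operatorname{Im}F$. $\Pi^x$ is the orthogonal projection onto the range of $\nabla F(x)$. Fix for each $x$ an SVD of $\nabla F(x)$ with singular values $\sigma^x_1\ge\sigma^x_2\ge\cdots$; $\Pi^x_j$ is the orthogonal projection onto the span of the top $j$ left singular vectors. For $\lambda>0$, $P(x,\lambda)=\nabla F(x)(\nabla F(x)^\top\nabla F(x)+\lambda I)^{-1}\nabla F(x)^\top$. LMM (Levenberg-Morrison-Marquardt) method. Given $x_0\in\mathbf{E}$, stepsizes $\gamma_k>0$ and damping coefficients $\lambda_k>0$: for $k\ge0$ let $v_k=\nabla h(F(x_k))$ and set $x_{k+1}=x_k-\gamma_k(\nabla F(x_k)^\top\nabla F(x_k)+\lambda_kI)^{-1}\nabla F(x_k)^\top v_k$. Write $z_k=F(x_k)$. Polyak configuration with parameters $\gamma>0$, $0<C_{\mathtt{lb}}\le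 C_{\mathtt{ub}}$: $\gamma_k=\gamma\frac{h(z_k)-h^\star}{\|\Pi^{x_k}v_k\|^2}$ and $C_{\mathtt{lb}}\operatorname{dist}(z_k,\mathcal{Z}^\star)\le\lambda_k\le C_{\mathtt{ub}}\operatorname{dist}(z_k,\mathcal{Z}^\star)$ for all $k$. $\nabla F$ is $L_{\nabla F}$-Lipschitz ($L_{\nabla F}\ge0$): $\|\nabla F(x)-\nabla F(y)\|_{\mathrm{op}}\le L_{\nabla F}\|x-y\|$ for all $x,y\in\mathbf{E}$. $F$ is strongly aligned at $z^\star\in\operatorname{Im}F$ with function $\delta:\mathbb{R}_+\to\mathbb{R}_+$ and constant $s>0$: for any $\rho>0$ and any $z=F(x)\in B_{\delta(\rho)}(z^\star)$ there is an index $j$ with $\|(I-\Pi^x_j)(z-z^\star)\|\le\rho\|z-z^\star\|$ and $(\sigma^x_j)^2\ge s$. $h$ is $(\alpha,\beta)$-regular (smooth sense) for $F$ ($\alpha,\beta>0$): (1) $h$ has a unique minimizer $z^\star$ over $\operatorname{Im}F$; (2) $h$ is convex; (3) $h(z)-h^\star\ge\frac{\alpha}{2}\|z-z^\star\|^2$ for all $z\in\operatorname{Im}F$; (4a) for all $x\in\mathbf{E}$ and $z=F(x)$, $\|\Pi^x\nabla h(z)\|\le\beta\|z-z^\star\|$ and $h(z)-h^\star\ge\frac1{2\beta}\|\Pi^x\nabla h(z)\|^2$; (4b) for all $x\in\mathbf{E}$, $z=F(x)$, $\lambda>0$, $|\langle\nabla h(z),(I-P(x,\lambda))(z-z^\star)\rangle|\le\beta\|z-z^\star\|\,\|(I-P(x,\lambda))(z-z^\star)\|$.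 *)

theory Defs
  imports "HOL-Analysis.Analysis"
begin

definition Jac ::
  "('e::euclidean_space \<Rightarrow> 'y::euclidean_space) \<Rightarrow> 'e \<Rightarrow> ('e \<Rightarrow>\<^sub>L 'y)" where
  "Jac F x = Blinfun (frechet_derivative F (at x))"

(* The type of bounded linear maps carries the operator norm, so continuity and
   Lipschitz continuity of Jac F are with respect to that norm. *)
definition cont_differentiable ::
  "('e::euclidean_space \<Rightarrow> 'y::euclidean_space) \<Rightarrow> bool" where
  "cont_differentiable F \<longleftrightarrow>
     (\<forall>x. F differentiable (at x)) \<and> continuous_on UNIV (Jac F)"

definition grad :: "('y::euclidean_space \<Rightarrow> real) \<Rightarrow> 'y \<Rightarrow> 'y" where
  "grad h z = (THE g. GDERIV h z :> g)"

definition min_value :: "('y \<Rightarrow> real) \<Rightarrow> 'y set \<Rightarrow> real" where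
  "min_value h S = (INF z\<in>S. h z)"

definition minimizers :: "('y \<Rightarrow> real) \<Rightarrow> 'y set \<Rightarrow> 'y set" where
  "minimizers h S = {z \<in> S. \<forall>w\<in>S. h z \<le> h w}"

definition orth_proj :: "'y::euclidean_space set \<Rightarrow> 'y \<Rightarrow> 'y" where
  "orth_proj S v = (THE p. p \<in> S \<and> (\<forall>w\<in>S. orthogonal (v - p) w))"

definition range_proj ::
  "('e::euclidean_space \<Rightarrow> 'y::euclidean_space) \<Rightarrow> 'e \<Rightarrow> 'y \<Rightarrow> 'y" where
  "range_proj F x = orth_proj (range (blinfun_apply (Jac F x)))"

(* Thin singular value decomposition A = \<Sum>i. \<sigma> i * u i * (v i)^T. Indices start at 1;
   values of \<sigma>, u, v outside {1..min DIM('e) DIM('y)} are irrelevant. *)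
definition is_svd ::
  "('e::euclidean_space \<Rightarrow>\<^sub>L 'y::euclidean_space) \<Rightarrow>
   (nat \<Rightarrow> real) \<Rightarrow> (nat \<Rightarrow> 'y) \<Rightarrow> (nat \<Rightarrow> 'e) \<Rightarrow> bool" where
  "is_svd A \<sigma> u v \<longleftrightarrow>
     (let I = {1..min DIM('e) DIM('y)} in
        (\<forall>i\<in>I. \<forall>j\<in>I. u i \<bullet> u j = (if i = j then 1 else 0)) \<and>
        (\<forall>i\<in>I. \<forall>j\<in>I. v i \<bullet> v j = (if i = j then 1 else 0)) \<and>
        (\<forall>i\<in>I. 0 \<le> \<sigma> i) \<and>
        (\<forall>i\<in>I. \<forall>j\<in>I. i \<le> j \<longrightarrow> \<sigma> j \<le> \<sigma> i) \<and>
        (\<forall>e. blinfun_apply A e = (\<Sum>i\<in>I. (\<sigma> i * (v i \<bullet> e)) *\<^sub>R u i)))"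

definition top_proj :: "(nat \<Rightarrow> 'y::euclidean_space) \<Rightarrow> nat \<Rightarrow> 'y \<Rightarrow> 'y" where
  "top_proj u j = orth_proj (span (u ` {1..j}))"

definition damped_inv ::
  "('e::euclidean_space \<Rightarrow>\<^sub>L 'y::euclidean_space) \<Rightarrow> real \<Rightarrow> 'e \<Rightarrow> 'e" where
  "damped_inv A l = inv (\<lambda>w. adjoint (blinfun_apply A) (blinfun_apply A w) + l *\<^sub>R w)"

definition damped_proj ::
  "('e::euclidean_space \<Rightarrow> 'y::euclidean_space) \<Rightarrow> 'e \<Rightarrow> real \<Rightarrow> 'y \<Rightarrow> 'y" where
  "damped_proj F x l w =
     blinfun_apply (Jac F x) (damped_inv (Jac F x) l (adjoint (blinfun_apply (Jac F x)) w))"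

definition LMM_sequence ::
  "('y::euclidean_space \<Rightarrow> real) \<Rightarrow> ('e::euclidean_space \<Rightarrow> 'y) \<Rightarrow> 'e \<Rightarrow>
   (nat \<Rightarrow> real) \<Rightarrow> (nat \<Rightarrow> real) \<Rightarrow> (nat \<Rightarrow> 'e) \<Rightarrow> bool" where
  "LMM_sequence h F x0 \<gamma>s \<mu>s x \<longleftrightarrow>
     x 0 = x0 \<and> (\<forall>k. 0 < \<gamma>s k) \<and> (\<forall>k. 0 < \<mu>s k) \<and>
     (\<forall>k. x (Suc k) = x k - \<gamma>s k *\<^sub>R
            damped_inv (Jac F (x k)) (\<mu>s k)
              (adjoint (blinfun_apply (Jac F (x k))) (grad h (F (x k)))))"

definition Polyak_config ::
  "('y::euclidean_space \<Rightarrow> real) \<Rightarrow> ('e::euclidean_space \<Rightarrow> 'y) \<Rightarrow> real \<Rightarrow> real \<Rightarrow> real \<Rightarrow>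
   (nat \<Rightarrow> real) \<Rightarrow> (nat \<Rightarrow> real) \<Rightarrow> (nat \<Rightarrow> 'e) \<Rightarrow> bool" where
  "Polyak_config h F \<gamma> C\<^sub>l\<^sub>b C\<^sub>u\<^sub>b \<gamma>s \<mu>s x \<longleftrightarrow>
     0 < \<gamma> \<and> 0 < C\<^sub>l\<^sub>b \<and> C\<^sub>l\<^sub>b \<le> C\<^sub>u\<^sub>b \<and>
     (\<forall>k. \<gamma>s k = \<gamma> * ((h (F (x k)) - min_value h (range F))
                       / (norm (range_proj F (x k) (grad h (F (x k)))))\<^sup>2)) \<and>
     (\<forall>k. C\<^sub>l\<^sub>b * infdist (F (x k)) (minimizers h (range F)) \<le> \<mu>s k \<and>
          \<mu>s k \<le> C\<^sub>u\<^sub>b * infdist (F (x k)) (minimizers h (range F)))"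

(* Given a chosen SVD of each Jac F x, with singular values \<sigma> x and left singular vectors u x. *)
definition strongly_aligned ::
  "('e::euclidean_space \<Rightarrow> 'y::euclidean_space) \<Rightarrow> ('e \<Rightarrow> nat \<Rightarrow> real) \<Rightarrow> ('e \<Rightarrow> nat \<Rightarrow> 'y) \<Rightarrow>
   'y \<Rightarrow> (real \<Rightarrow> real) \<Rightarrow> real \<Rightarrow> bool" where
  "strongly_aligned F \<sigma> u zs \<delta> s \<longleftrightarrow>
     zs \<in> range F \<and> (\<forall>\<rho>>0. 0 < \<delta> \<rho>) \<and> 0 < s \<and>
     (\<forall>\<rho>>0. \<forall>x. F x \<in> cball zs (\<delta> \<rho>) \<longrightarrow>
        (\<exists>j\<in>{1..min DIM('e) DIM('y)}.
           norm ((F x - zs) - top_proj (u x) j (F x - zs)) \<le> \<rho> * norm (F x - zs) \<and>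
           (\<sigma> x j)\<^sup>2 \<ge> s))"

definition regular_smooth ::
  "('y::euclidean_space \<Rightarrow> real) \<Rightarrow> ('e::euclidean_space \<Rightarrow> 'y) \<Rightarrow> real \<Rightarrow> real \<Rightarrow> 'y \<Rightarrow> bool" where
  "regular_smooth h F \<alpha> \<beta> zs \<longleftrightarrow>
     0 < \<alpha> \<and> 0 < \<beta> \<and>
     minimizers h (range F) = {zs} \<and>
     convex_on UNIV h \<and>
     (\<forall>z\<in>range F. h z - min_value h (range F) \<ge> \<alpha> / 2 * (norm (z - zs))\<^sup>2) \<and>
     (\<forall>x. norm (range_proj F x (grad h (F x))) \<le> \<beta> * norm (F x - zs) \<and>
          h (F x) - min_value h (range F)
            \<ge> 1 / (2 * \<beta>) * (norm (range_proj F x (grad h (F x))))\<^sup>2) \<and>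
     (\<forall>x l. 0 < l \<longrightarrow>
          \<bar>grad h (F x) \<bullet> ((F x - zs) - damped_proj F x l (F x - zs))\<bar>
            \<le> \<beta> * norm (F x - zs) * norm ((F x - zs) - damped_proj F x l (F x - zs)))"

end

theory Submission imports Defs begin

text \<open>
  Let \<open>A\<close> be the Jacobian at the current point, \<open>z\<close> its image, \<open>v\<close> the gradient of \<open>h\<close> at \<open>z\<close>, and
  let \<open>P = A (A\<^sup>T A + l I)\<^sup>-\<^sup>1 A\<^sup>T\<close> be the damped projection.  A step with step size \<open>g\<close> moves \<open>z\<close> to
  \<open>z - g P v + E\<close>, where \<open>E\<close> is the error of linearizing \<open>F\<close>.  If \<open>P\<close> were the identity and \<open>E\<close>
  were zero, this would be the gradient method in the image space, and convexity with
  quadratic growth and the bound of the squared gradient by the gap would make it converge linearly.  Two perturbations have to be absorbed.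

  The damping.  For a vector of the form \<open>A A\<^sup>T b\<close> one has \<open>(I - P) A A\<^sup>T b = l P b\<close>, and the top left
  singular subspace consists of such vectors, with \<open>b\<close> at most \<open>1 / s\<close> times as long.
  Strong alignment puts \<open>z - z\<^sup>*\<close> close to that subspace, so \<open>(I - P) (z - z\<^sup>*)\<close> is small
  (\<open>aligned_residual\<close>).  Hence \<open>P v\<close> keeps at least three quarters of the correlation with
  \<open>z - z\<^sup>*\<close> that convexity promises (\<open>damped_grad_correlation\<close>).

  The linearization.  Since the Jacobian is \<open>L\<close>-Lipschitz, the length of \<open>E\<close> is at most
  \<open>L / 2\<close> times the squared parameter step (\<open>linearization_error\<close>).  The parameter step is
  \<open>g w\<close> with \<open>w = (A\<^sup>T A + l I)\<^sup>-\<^sup>1 A\<^sup>T v\<close>.  Testing the equation for \<open>w\<close> with \<open>w\<close>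
  itself shows that the squared length of \<open>P v\<close> plus \<open>l\<close> times that of \<open>w\<close> equals the inner
  product of \<open>P v\<close> with \<open>v\<close> (\<open>damped_proj_energy\<close>).  This identity replaces a spectral
  analysis of \<open>P\<close>: it bounds \<open>w\<close>, \<open>P v\<close> and \<open>I - P\<close>.  In particular the squared length of
  \<open>w\<close> is at most inversely proportional to the damping, and the damping is comparable to the distance to \<open>z\<^sup>*\<close>
  (for Polyak steps) or to the current bound on it (for constant steps).  So the cross term between
  \<open>E\<close> and \<open>z - z\<^sup>*\<close> is of the same order as the decrease, with a smaller constant.

  Together this gives a contraction of the squared error in each step
  (\<open>Polyak_step_contraction\<close>, \<open>constant_step_contraction\<close>).  The iterates then stay where alignment
  applies, and induction finishes the proof.
\<close>

section \<open>Orthogonal projections and least-squares damping\<close>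

lemma orth_proj_works:
  fixes S :: "'y::euclidean_space set"
  assumes "subspace S"
  shows orth_proj_in: "orth_proj S y \<in> S"
    and inner_orth_proj: "w \<in> S \<Longrightarrow> w \<bullet> orth_proj S y = w \<bullet> y"
proof -
  obtain p q where pq: "p \<in> span S" "\<And>w. w \<in> span S \<Longrightarrow> orthogonal q w" "y = p + q"
    using orthogonal_subspace_decomp_exists by blast
  have span: "span S = S" using assms by (simp add: span_eq_iff)
  have ex: "p \<in> S \<and> (\<forall>w\<in>S. orthogonal (y - p) w)"
    using pq span by auto
  have uniq: "p' = p" if p': "p' \<in> S \<and> (\<forall>w\<in>S. orthogonal (y - p') w)" for p'
  proof -
    have "p' - p \<in> S" using ex p' assms by (simp add: subspace_diff)
    then have "(y - p) \<bullet> (p' - p) = 0" "(y - p') \<bullet> (p' - p) = 0"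
      using ex p' by (auto simp: orthogonal_def)
    moreover have "(p' - p) \<bullet> (p' - p) = (y - p) \<bullet> (p' - p) - (y - p') \<bullet> (p' - p)"
      by (simp add: inner_diff_left)
    ultimately have "(p' - p) \<bullet> (p' - p) = 0" by simp
    then show ?thesis by simp
  qed
  have "orth_proj S y = p"
    unfolding orth_proj_def by (rule the_equality) (fact ex, rule uniq)
  then have *: "orth_proj S y \<in> S \<and> (\<forall>w\<in>S. orthogonal (y - orth_proj S y) w)"
    using ex by simp
  then show "orth_proj S y \<in> S" by simp
  show "w \<bullet> orth_proj S y = w \<bullet> y" if "w \<in> S"
  proof -
    have "(y - orth_proj S y) \<bullet> w = 0" using * that unfolding orthogonal_def by blast
    then show ?thesis by (metis inner_diff_left inner_commute right_minus_eq)
  qed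
qed

lemma adjoint_blinfun:
  fixes A :: "'e::euclidean_space \<Rightarrow>\<^sub>L 'y::euclidean_space"
  shows inner_adjoint_blinfun: "w \<bullet> adjoint (blinfun_apply A) y = blinfun_apply A w \<bullet> y"
    and linear_adjoint_blinfun: "linear (adjoint (blinfun_apply A))"
proof -
  have lin: "linear (blinfun_apply A)"
    using blinfun.bounded_linear_right bounded_linear.linear by blast
  show "w \<bullet> adjoint (blinfun_apply A) y = blinfun_apply A w \<bullet> y"
    using adjoint_works[OF lin] by simp
  show "linear (adjoint (blinfun_apply A))" by (rule adjoint_linear[OF lin])
qed

lemma bij_damped:
  fixes A :: "'e::euclidean_space \<Rightarrow>\<^sub>L 'y::euclidean_space"
  assumes "0 < l"
  shows "bij (\<lambda>w. adjoint (blinfun_apply A) (blinfun_apply A w) + l *\<^sub>R w)" (is "bij ?f")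
proof -
  have adj: "linear (adjoint (blinfun_apply A))" by (rule linear_adjoint_blinfun)
  have lin: "linear ?f"
    by (rule linearI)
       (simp_all add: blinfun.add_right blinfun.scaleR_right linear_add[OF adj]
          linear_scale[OF adj] algebra_simps)
  have "inj ?f"
  proof (subst linear_injective_0[OF lin], intro allI impI)
    fix w assume "?f w = 0"
    then have "w \<bullet> ?f w = 0" by simp
    then have "(norm (blinfun_apply A w))\<^sup>2 + l * (norm w)\<^sup>2 = 0"
      by (simp add: inner_add_right inner_adjoint_blinfun power2_norm_eq_inner)
    moreover have "0 \<le> l * (norm w)\<^sup>2" using assms by simp
    ultimately have "l * (norm w)\<^sup>2 = 0"
      by (smt (verit) zero_le_power2)
    then show "w = 0" using assms by simp
  qed
  then show ?thesis
    using linear_injective_imp_surjective[OF lin] by (simp add: bij_def)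
qed

lemma damped_inv_solves:
  assumes "0 < l"
  shows "adjoint (blinfun_apply A) (blinfun_apply A (damped_inv A l r)) + l *\<^sub>R damped_inv A l r = r"
  unfolding damped_inv_def
  using surj_f_inv_f[OF bij_is_surj[OF bij_damped[OF assms, of A]]] by simp

lemma damped_inv_unique:
  assumes "0 < l" "adjoint (blinfun_apply A) (blinfun_apply A w) + l *\<^sub>R w = r"
  shows "damped_inv A l r = w"
  unfolding damped_inv_def
  using inv_f_eq[OF bij_is_inj[OF bij_damped[OF assms(1), of A]] assms(2)] by simp

text \<open>The equation that defines \<open>w\<close>, tested with \<open>w\<close>.\<close>

lemma damped_proj_energy:
  fixes F :: "'e::euclidean_space \<Rightarrow> 'y::euclidean_space" and x :: 'e and y :: 'y
  assumes "0 < l"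
  defines "w \<equiv> damped_inv (Jac F x) l (adjoint (blinfun_apply (Jac F x)) y)"
  shows "(norm (damped_proj F x l y))\<^sup>2 + l * (norm w)\<^sup>2 = damped_proj F x l y \<bullet> y"
proof -
  have "w \<bullet> (adjoint (blinfun_apply (Jac F x)) (blinfun_apply (Jac F x) w) + l *\<^sub>R w)
      = w \<bullet> adjoint (blinfun_apply (Jac F x)) y"
    unfolding w_def by (simp only: damped_inv_solves[OF assms(1)])
  then show ?thesis
    by (simp add: inner_add_right inner_adjoint_blinfun damped_proj_def w_def power2_norm_eq_inner)
qed

text \<open>Both sides are values of the same symmetric bilinear form, that of \<open>A\<^sup>T A + l I\<close>, at the
two solutions.\<close>

lemma damped_proj_symmetric:
  assumes "0 < l"
  shows "damped_proj F x l y \<bullet> y' = y \<bullet> damped_proj F x l y'"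
proof -
  define A where "A = blinfun_apply (Jac F x)"
  define S where "S = damped_inv (Jac F x) l"
  have solves: "adjoint A (A (S r)) + l *\<^sub>R S r = r" for r
    unfolding A_def S_def by (rule damped_inv_solves[OF assms])
  have inner_adj: "w \<bullet> adjoint A r = A w \<bullet> r" for w r
    unfolding A_def by (rule inner_adjoint_blinfun)
  let ?w = "S (adjoint A y)" and ?w' = "S (adjoint A y')"
  have "A ?w \<bullet> y' = ?w \<bullet> (adjoint A (A ?w') + l *\<^sub>R ?w')"
    by (simp add: solves inner_adj)
  also have "\<dots> = ?w' \<bullet> (adjoint A (A ?w) + l *\<^sub>R ?w)"
    by (simp add: inner_adj inner_add_right inner_commute)
  also have "\<dots> = A ?w' \<bullet> y"
    by (simp only: solves inner_adj)
  finally show ?thesis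
    by (simp add: damped_proj_def A_def S_def inner_commute)
qed

lemma damped_proj_add:
  assumes "0 < l"
  shows "damped_proj F x l (y + y') = damped_proj F x l y + damped_proj F x l y'"
proof -
  have "damped_proj F x l (y + y') \<bullet> b = (damped_proj F x l y + damped_proj F x l y') \<bullet> b" for b
    by (simp add: damped_proj_symmetric[OF assms] inner_add_left)
  then show ?thesis by (metis vector_eq_rdot)
qed

lemma norm_damped_proj_le:
  assumes "0 < l"
  shows "norm (damped_proj F x l y) \<le> norm y"
proof -
  have "(norm (damped_proj F x l y))\<^sup>2 \<le> damped_proj F x l y \<bullet> y"
    using damped_proj_energy[OF assms, of F x y] assms
    by (smt (verit) mult_nonneg_nonneg zero_le_power2)
  also have "\<dots> \<le> norm (damped_proj F x l y) * norm y" by (rule norm_cauchy_schwarz)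
  finally show ?thesis
    by (smt (verit) mult_le_cancel_left_pos norm_ge_zero power2_eq_square)
qed

text \<open>Expanding the square leaves \<open>p\<^sup>2 - 2 \<langle>P y, y\<rangle>\<close> beyond the squared length of \<open>y\<close>, with \<open>p\<close> the
length of \<open>P y\<close>, and the energy identity makes this nonpositive.\<close>

lemma norm_diff_damped_proj_le:
  assumes "0 < l"
  shows "norm (y - damped_proj F x l y) \<le> norm y"
proof (rule power2_le_imp_le)
  have "(norm (damped_proj F x l y))\<^sup>2 \<le> damped_proj F x l y \<bullet> y"
    using damped_proj_energy[OF assms, of F x y] assms
    by (smt (verit) mult_nonneg_nonneg zero_le_power2)
  then show "(norm (y - damped_proj F x l y))\<^sup>2 \<le> (norm y)\<^sup>2"
    by (simp add: power2_norm_eq_inner inner_diff_left inner_diff_right inner_commute)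
       (smt (verit) inner_ge_zero)
qed simp

text \<open>Applying the damped inverse to \<open>A\<^sup>T A c = (A\<^sup>T A + l I) c - l c\<close> with \<open>c = A\<^sup>T b\<close> shows that
on such vectors damping changes the identity only by a term proportional to \<open>l\<close>.\<close>

lemma damped_proj_residual:
  fixes F :: "'e::euclidean_space \<Rightarrow> 'y::euclidean_space" and x :: 'e
  assumes "0 < l"
  defines "A \<equiv> blinfun_apply (Jac F x)"
  shows "A (adjoint A b) - damped_proj F x l (A (adjoint A b)) = l *\<^sub>R damped_proj F x l b"
proof -
  have lin: "linear (adjoint A)" and add: "\<And>c d. A (c - d) = A c - A d"
    and scale: "\<And>t c. A (t *\<^sub>R c) = t *\<^sub>R A c"
    unfolding A_def by (simp_all add: linear_adjoint_blinfun blinfun.diff_right blinfun.scaleR_right)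
  define w where "w = damped_inv (Jac F x) l (adjoint A b)"
  have w: "adjoint A (A w) + l *\<^sub>R w = adjoint A b"
    unfolding w_def A_def by (rule damped_inv_solves[OF assms(1)])
  have "damped_inv (Jac F x) l (adjoint A (A (adjoint A b))) = adjoint A b - l *\<^sub>R w"
  proof (rule damped_inv_unique[OF assms(1)], fold A_def)
    have "adjoint A (A (adjoint A b - l *\<^sub>R w)) + l *\<^sub>R (adjoint A b - l *\<^sub>R w)
        = adjoint A (A (adjoint A b)) + l *\<^sub>R (adjoint A b - (adjoint A (A w) + l *\<^sub>R w))"
      by (simp add: add scale linear_diff[OF lin] linear_scale[OF lin] algebra_simps)
    then show "adjoint A (A (adjoint A b - l *\<^sub>R w)) + l *\<^sub>R (adjoint A b - l *\<^sub>R w)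
        = adjoint A (A (adjoint A b))"
      by (simp add: w)
  qed
  then show ?thesis
    by (simp add: damped_proj_def A_def[symmetric] add scale w_def)
qed

section \<open>Alignment controls the damping residual\<close>

lemma svd_left_singular:
  fixes A :: "'e::euclidean_space \<Rightarrow>\<^sub>L 'y::euclidean_space"
  assumes svd: "is_svd A \<sigma> u v" and i: "i \<in> {1..min DIM('e) DIM('y)}"
  shows "blinfun_apply A (adjoint (blinfun_apply A) (u i)) = (\<sigma> i)\<^sup>2 *\<^sub>R u i"
proof -
  let ?I = "{1..min DIM('e) DIM('y)}"
  have u: "\<And>k j. k \<in> ?I \<Longrightarrow> j \<in> ?I \<Longrightarrow> u k \<bullet> u j = (if k = j then 1 else 0)"
    and v: "\<And>k j. k \<in> ?I \<Longrightarrow> j \<in> ?I \<Longrightarrow> v k \<bullet> v j = (if k = j then 1 else 0)"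
    and A: "\<And>e. blinfun_apply A e = (\<Sum>k\<in>?I. (\<sigma> k * (v k \<bullet> e)) *\<^sub>R u k)"
    using svd unfolding is_svd_def Let_def by blast+
  have "e \<bullet> adjoint (blinfun_apply A) (u i) = e \<bullet> (\<sigma> i *\<^sub>R v i)" for e
  proof -
    have "e \<bullet> adjoint (blinfun_apply A) (u i) = (\<Sum>k\<in>?I. \<sigma> k * (v k \<bullet> e) * (u k \<bullet> u i))"
      by (simp only: inner_adjoint_blinfun A inner_sum_left inner_scaleR_left)
    also have "\<dots> = (\<Sum>k\<in>?I. if k = i then \<sigma> i * (v i \<bullet> e) else 0)"
      by (intro sum.cong refl) (use u i in auto)
    finally show ?thesis using i by (simp add: inner_commute)
  qed
  then have adj: "adjoint (blinfun_apply A) (u i) = \<sigma> i *\<^sub>R v i"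
    by (metis vector_eq_ldot)
  have "blinfun_apply A (v i) = (\<Sum>k\<in>?I. if k = i then \<sigma> i *\<^sub>R u i else 0)"
    unfolding A by (intro sum.cong refl) (use v i in auto)
  then have "blinfun_apply A (v i) = \<sigma> i *\<^sub>R u i" using i by simp
  then show ?thesis by (simp add: adj blinfun.scaleR_right power2_eq_square)
qed

text \<open>On the top singular subspace \<open>A A\<^sup>T\<close> acts diagonally with eigenvalues \<open>(\<sigma> i)\<^sup>2 \<ge> s\<close>, so
dividing the coefficients by these eigenvalues inverts it there with norm at most \<open>1 / s\<close>.\<close>

lemma top_proj_preimage:
  fixes A :: "'e::euclidean_space \<Rightarrow>\<^sub>L 'y::euclidean_space"
  assumes svd: "is_svd A \<sigma> u v" and j: "j \<in> {1..min DIM('e) DIM('y)}"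
    and s: "0 < s" "s \<le> (\<sigma> j)\<^sup>2"
  obtains b where "blinfun_apply A (adjoint (blinfun_apply A) b) = top_proj u j y"
    and "norm b \<le> norm y / s"
proof -
  let ?I = "{1..min DIM('e) DIM('y)}"
  have sub: "{1..j} \<subseteq> ?I" using j by auto
  have u: "\<And>k i. k \<in> ?I \<Longrightarrow> i \<in> ?I \<Longrightarrow> u k \<bullet> u i = (if k = i then 1 else 0)"
    and nonneg: "\<And>k. k \<in> ?I \<Longrightarrow> 0 \<le> \<sigma> k"
    and dec: "\<And>k i. k \<in> ?I \<Longrightarrow> i \<in> ?I \<Longrightarrow> k \<le> i \<Longrightarrow> \<sigma> i \<le> \<sigma> k"
    using svd unfolding is_svd_def Let_def by blast+
  have s\<sigma>: "s \<le> (\<sigma> i)\<^sup>2" if "i \<in> {1..j}" for i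
  proof -
    have "\<sigma> j \<le> \<sigma> i" "0 \<le> \<sigma> j" using that j sub dec nonneg by auto
    then have "(\<sigma> j)\<^sup>2 \<le> (\<sigma> i)\<^sup>2" by (simp add: power_mono)
    then show ?thesis using s by simp
  qed
  have orth: "pairwise orthogonal (u ` {1..j})"
    unfolding pairwise_def orthogonal_def using u sub by (smt (verit) imageE subsetD)
  have inner_sum: "(\<Sum>i=1..j. c i *\<^sub>R u i) \<bullet> (\<Sum>i=1..j. c i *\<^sub>R u i) = (\<Sum>i=1..j. (c i)\<^sup>2)" for c
  proof -
    have "(\<Sum>i=1..j. c i *\<^sub>R u i) \<bullet> (\<Sum>i=1..j. c i *\<^sub>R u i)
        = (\<Sum>i=1..j. \<Sum>k=1..j. c i * (c k * (u i \<bullet> u k)))"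
      by (simp add: inner_sum_left inner_sum_right sum_distrib_left inner_commute mult.left_commute)
    also have "\<dots> = (\<Sum>i=1..j. \<Sum>k=1..j. if k = i then (c i)\<^sup>2 else 0)"
      by (intro sum.cong refl) (use u sub in \<open>auto simp: power2_eq_square subset_iff\<close>)
    also have "\<dots> = (\<Sum>i=1..j. (c i)\<^sup>2)" by simp
    finally show ?thesis .
  qed
  define p where "p = top_proj u j y"
  have p_in: "p \<in> span (u ` {1..j})"
    unfolding p_def top_proj_def by (rule orth_proj_in[OF subspace_span])
  have p_inner: "w \<bullet> p = w \<bullet> y" if "w \<in> span (u ` {1..j})" for w
    unfolding p_def top_proj_def by (rule inner_orth_proj[OF subspace_span that])
  \<comment> \<open>Both sides lie in the span and have the same inner products with its generators.\<close>
  have expand: "p = (\<Sum>i=1..j. (p \<bullet> u i) *\<^sub>R u i)"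
  proof -
    let ?q = "\<Sum>i=1..j. (p \<bullet> u i) *\<^sub>R u i"
    have "orthogonal (p - ?q) w" if w: "w \<in> u ` {1..j}" for w
    proof -
      obtain k where k: "k \<in> {1..j}" "w = u k" using w by blast
      have "?q \<bullet> u k = (\<Sum>i=1..j. if i = k then p \<bullet> u k else 0)"
        unfolding inner_sum_left by (intro sum.cong refl) (use u sub k in \<open>auto simp: subset_iff\<close>)
      also have "\<dots> = p \<bullet> u k" using k by simp
      finally show ?thesis using k by (simp add: orthogonal_def inner_diff_left)
    qed
    then have orth': "orthogonal (p - ?q) w" if "w \<in> span (u ` {1..j})" for w
      using orthogonal_to_span that by (metis (no_types, lifting))
    have "?q \<in> span (u ` {1..j})"
      by (intro span_sum span_scale span_base) auto
    then have "p - ?q \<in> span (u ` {1..j})" using p_in by (simp add: span_diff)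
    then have "orthogonal (p - ?q) (p - ?q)" using orth' by blast
    then show ?thesis by (simp add: orthogonal_self)
  qed
  define b where "b = (\<Sum>i=1..j. ((p \<bullet> u i) / (\<sigma> i)\<^sup>2) *\<^sub>R u i)"
  have lin: "linear (adjoint (blinfun_apply A))" by (rule linear_adjoint_blinfun)
  have "blinfun_apply A (adjoint (blinfun_apply A) b)
      = (\<Sum>i=1..j. ((p \<bullet> u i) / (\<sigma> i)\<^sup>2) *\<^sub>R blinfun_apply A (adjoint (blinfun_apply A) (u i)))"
    unfolding b_def by (simp add: linear_sum[OF lin] linear_scale[OF lin] blinfun.sum_right blinfun.scaleR_right)
  also have "\<dots> = (\<Sum>i=1..j. (p \<bullet> u i) *\<^sub>R u i)"
  proof (intro sum.cong refl)
    fix i assume i: "i \<in> {1..j}"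
    then have "(\<sigma> i)\<^sup>2 \<noteq> 0" using s\<sigma>[OF i] s by linarith
    then show "((p \<bullet> u i) / (\<sigma> i)\<^sup>2) *\<^sub>R blinfun_apply A (adjoint (blinfun_apply A) (u i)) = (p \<bullet> u i) *\<^sub>R u i"
      using svd_left_singular[OF svd, of i] i sub by (auto simp: subset_iff)
  qed
  finally have Ab: "blinfun_apply A (adjoint (blinfun_apply A) b) = p" using expand by simp
  have "(norm b)\<^sup>2 = (\<Sum>i=1..j. ((p \<bullet> u i) / (\<sigma> i)\<^sup>2)\<^sup>2)"
    unfolding power2_norm_eq_inner b_def by (rule inner_sum)
  also have "\<dots> \<le> (\<Sum>i=1..j. ((p \<bullet> u i) / s)\<^sup>2)"
  proof (rule sum_mono)
    fix i assume i: "i \<in> {1..j}"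
    have "\<bar>(p \<bullet> u i) / (\<sigma> i)\<^sup>2\<bar> \<le> \<bar>(p \<bullet> u i) / s\<bar>"
      using s\<sigma>[OF i] s by (simp add: frac_le)
    then show "((p \<bullet> u i) / (\<sigma> i)\<^sup>2)\<^sup>2 \<le> ((p \<bullet> u i) / s)\<^sup>2" by (simp only: abs_le_square_iff)
  qed
  also have "\<dots> = (\<Sum>i=1..j. (p \<bullet> u i)\<^sup>2) / s\<^sup>2"
    by (simp add: power_divide sum_divide_distrib)
  also have "(\<Sum>i=1..j. (p \<bullet> u i)\<^sup>2) = (norm p)\<^sup>2"
    using inner_sum[of "\<lambda>i. p \<bullet> u i"] expand by (simp add: power2_norm_eq_inner)
  finally have "norm b \<le> norm p / s"
    using s by (simp add: power_divide[symmetric] power2_le_iff_abs_le)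
  moreover have "norm p \<le> norm y"
  proof -
    have "norm p * norm p \<le> norm p * norm y"
      using p_inner[OF p_in] norm_cauchy_schwarz[of p y]
      by (simp add: power2_norm_eq_inner[symmetric] power2_eq_square[symmetric])
    then show ?thesis by (smt (verit) mult_le_cancel_left_pos norm_ge_zero)
  qed
  ultimately have "norm b \<le> norm y / s" using s by (smt (verit) divide_right_mono)
  then show thesis using Ab that p_def by blast
qed

text \<open>Split the error into its top part and its tail.  The residual of the tail is no longer than
the tail, and the top part is \<open>A A\<^sup>T b\<close>, whose residual is \<open>l P b\<close>.\<close>

lemma aligned_residual:
  fixes F :: "'e::euclidean_space \<Rightarrow> 'y::euclidean_space"
  assumes svd: "is_svd (Jac F x) (\<sigma> x) (u x) (v x)"
    and al: "strongly_aligned F \<sigma> u zs \<delta> s" and \<rho>: "0 < \<rho>" "norm (F x - zs) \<le> \<delta> \<rho>"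
    and l: "0 < l"
  shows "norm ((F x - zs) - damped_proj F x l (F x - zs)) \<le> (\<rho> + l / s) * norm (F x - zs)"
proof -
  define y where "y = F x - zs"
  have s: "0 < s" using al by (simp add: strongly_aligned_def)
  have "F x \<in> cball zs (\<delta> \<rho>)" using \<rho> by (simp add: dist_norm norm_minus_commute)
  then obtain j where j: "j \<in> {1..min DIM('e) DIM('y)}"
    and tail: "norm (y - top_proj (u x) j y) \<le> \<rho> * norm y" and sj: "s \<le> (\<sigma> x j)\<^sup>2"
    using al \<rho>(1) unfolding strongly_aligned_def y_def by blast
  obtain b where b: "blinfun_apply (Jac F x) (adjoint (blinfun_apply (Jac F x)) b) = top_proj (u x) j y"
    and nb: "norm b \<le> norm y / s"
    using top_proj_preimage[OF svd j s sj] by blast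
  let ?P = "damped_proj F x l" and ?t = "top_proj (u x) j y"
  have "y - ?P y = ((y - ?t) - ?P (y - ?t)) + (?t - ?P ?t)"
    using damped_proj_add[OF l, of F x "y - ?t" ?t] by simp
  moreover have "?t - ?P ?t = l *\<^sub>R ?P b" using damped_proj_residual[OF l, of F x b] b by simp
  ultimately have "norm (y - ?P y) \<le> norm ((y - ?t) - ?P (y - ?t)) + norm (l *\<^sub>R ?P b)"
    by (metis norm_triangle_ineq)
  also have "\<dots> \<le> norm (y - ?t) + l * norm b"
    using norm_diff_damped_proj_le[OF l, of "y - ?t" F x] norm_damped_proj_le[OF l, of F x b] l
    by (simp add: add_mono)
  also have "\<dots> \<le> \<rho> * norm y + l * (norm y / s)"
    using tail nb l by (intro add_mono mult_left_mono) auto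
  finally show ?thesis by (simp add: y_def algebra_simps)
qed

section \<open>First-order inequalities for the two maps\<close>

text \<open>Restricted to the line through \<open>z\<close> and \<open>w\<close>, this is the tangent inequality for a convex
function of one real variable.\<close>

lemma convex_gradient_inequality:
  fixes h :: "'y::euclidean_space \<Rightarrow> real"
  assumes conv: "convex_on UNIV h" and diff: "h differentiable (at z)"
  shows "h z - h w \<le> grad h z \<bullet> (z - w)"
proof -
  obtain h' where h': "(h has_derivative h') (at z)" using diff unfolding differentiable_def by blast
  then have lin: "linear h'" using has_derivative_linear by blast
  define g where "g = adjoint h' 1"
  have "h' e = e \<bullet> g" for e using adjoint_works[OF lin, of e 1] by (simp add: g_def)
  then have "h' = (\<lambda>e. e \<bullet> g)" by blast
  then have g: "GDERIV h z :> g" using h' by (simp add: gderiv_def)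
  have uniq: "g' = g" if "GDERIV h z :> g'" for g'
  proof -
    have "(\<lambda>e. e \<bullet> g') = (\<lambda>e. e \<bullet> g)"
      using has_derivative_unique g that unfolding gderiv_def by blast
    then show ?thesis by (metis vector_eq_ldot)
  qed
  have grad: "grad h z = g" unfolding grad_def by (rule the_equality) (fact g, rule uniq)
  define \<phi> where "\<phi> t = h (z + t *\<^sub>R (w - z))" for t :: real
  have "convex_on UNIV \<phi>"
  proof (intro convex_onI)
    fix t x y :: real assume t: "0 < t" "t < 1"
    have "z + ((1 - t) *\<^sub>R x + t *\<^sub>R y) *\<^sub>R (w - z)
        = (1 - t) *\<^sub>R (z + x *\<^sub>R (w - z)) + t *\<^sub>R (z + y *\<^sub>R (w - z))"
      by (simp add: algebra_simps)
    then show "\<phi> ((1 - t) *\<^sub>R x + t *\<^sub>R y) \<le> (1 - t) * \<phi> x + t * \<phi> y"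
      unfolding \<phi>_def using convex_onD[OF conv, of t] t by simp
  qed simp
  moreover have "(\<phi> has_field_derivative (w - z) \<bullet> g) (at 0)"
  proof -
    have "((\<lambda>t. z + t *\<^sub>R (w - z)) has_derivative (\<lambda>t. t *\<^sub>R (w - z))) (at (0::real))"
      by (auto intro!: derivative_eq_intros)
    moreover have "(h has_derivative (\<lambda>e. e \<bullet> g)) (at (z + 0 *\<^sub>R (w - z)))"
      using g by (simp add: gderiv_def)
    ultimately have "((\<lambda>t. h (z + t *\<^sub>R (w - z))) has_derivative (\<lambda>t. (t *\<^sub>R (w - z)) \<bullet> g)) (at 0)"
      by (rule has_derivative_compose)
    then show ?thesis
      unfolding \<phi>_def has_field_derivative_def by (simp add: mult.commute[of _ "(w - z) \<bullet> g"])
  qed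
  ultimately have "(w - z) \<bullet> g * (1 - 0) \<le> \<phi> 1 - \<phi> 0"
    by (intro convex_on_imp_above_tangent[of UNIV]) auto
  then show ?thesis
    by (simp add: \<phi>_def grad inner_diff_left inner_diff_right inner_commute)
qed

text \<open>The constant \<open>L / 2\<close>, rather than \<open>L\<close>, comes from comparing the curve
\<open>F (x + t d) - t A d\<close> with the scalar function \<open>L / 2 * (norm d)\<^sup>2 * t\<^sup>2\<close>, whose derivative
dominates the speed of the curve at every positive time.\<close>

lemma linearization_error:
  fixes F :: "'e::euclidean_space \<Rightarrow> 'y::euclidean_space"
  assumes diff: "\<And>x. F differentiable (at x)" and lip: "L-lipschitz_on UNIV (Jac F)"
  shows "norm (F (x + d) - F x - blinfun_apply (Jac F x) d) \<le> L / 2 * (norm d)\<^sup>2"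
proof -
  have der: "(F has_derivative blinfun_apply (Jac F y)) (at y)" for y
  proof -
    have "(F has_derivative frechet_derivative F (at y)) (at y)"
      using diff frechet_derivative_works by blast
    then show ?thesis
      unfolding Jac_def using bounded_linear_Blinfun_apply has_derivative_bounded_linear by metis
  qed
  define f where "f t = F (x + t *\<^sub>R d) - t *\<^sub>R blinfun_apply (Jac F x) d" for t :: real
  define f' where "f' t = blinfun_apply (Jac F (x + t *\<^sub>R d)) d - blinfun_apply (Jac F x) d" for t :: real
  define \<phi> where "\<phi> t = L / 2 * (norm d)\<^sup>2 * t\<^sup>2" for t :: real
  have f: "(f has_vector_derivative f' t) (at t)" for t
  proof -
    have "((\<lambda>t. x + t *\<^sub>R d) has_derivative (\<lambda>t. t *\<^sub>R d)) (at t)"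
      by (auto intro!: derivative_eq_intros)
    then have "((\<lambda>t. F (x + t *\<^sub>R d)) has_derivative (\<lambda>t'. blinfun_apply (Jac F (x + t *\<^sub>R d)) (t' *\<^sub>R d))) (at t)"
      using has_derivative_compose[OF _ der] by blast
    then show ?thesis
      unfolding f_def f'_def has_vector_derivative_def
      by (auto intro!: derivative_eq_intros simp: blinfun.scaleR_right algebra_simps)
  qed
  have \<phi>: "(\<phi> has_vector_derivative L * (norm d)\<^sup>2 * t) (at t)" for t
    unfolding \<phi>_def has_real_derivative_iff_has_vector_derivative[symmetric]
    by (auto intro!: derivative_eq_intros)
  have bound: "norm (f' t) \<le> L * (norm d)\<^sup>2 * t" if "0 < t" for t
  proof -
    have "norm (f' t) \<le> norm (Jac F (x + t *\<^sub>R d) - Jac F x) * norm d"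
      unfolding f'_def by (metis blinfun.diff_left norm_blinfun)
    also have "norm (Jac F (x + t *\<^sub>R d) - Jac F x) \<le> L * norm (t *\<^sub>R d)"
      using lipschitz_onD[OF lip, of "x + t *\<^sub>R d" x] by (simp add: dist_norm)
    finally show ?thesis using that by (simp add: mult_right_mono power2_eq_square mult_ac)
  qed
  have "norm (f 1 - f 0) \<le> \<phi> 1 - \<phi> 0"
    by (rule differentiable_bound_general[where f' = f' and \<phi>' = "\<lambda>t. L * (norm d)\<^sup>2 * t"])
       (auto intro!: f \<phi> bound continuous_at_imp_continuous_on
          has_vector_derivative_continuous[OF f]
          has_vector_derivative_continuous[OF \<phi>])
  then show ?thesis by (simp add: f_def \<phi>_def algebra_simps)
qed

section \<open>One damped step\<close>

text \<open>Both step-size rules are analysed through the same quantities at a point \<open>x\<close>, so the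
standing hypotheses are collected once.  The damped gradient is, up to sign, the first-order
displacement in the image space per unit step size, and \<open>dir\<close> is the parameter step that produces it.\<close>

locale aligned_composition =
  fixes h :: "'y::euclidean_space \<Rightarrow> real" and F :: "'e::euclidean_space \<Rightarrow> 'y"
    and \<sigma> :: "'e \<Rightarrow> nat \<Rightarrow> real" and u :: "'e \<Rightarrow> nat \<Rightarrow> 'y" and v :: "'e \<Rightarrow> nat \<Rightarrow> 'e"
    and L \<alpha> \<beta> s :: real and \<delta> :: "real \<Rightarrow> real" and zs :: 'y
  assumes h_diff: "h differentiable (at z)"
    and F_diff: "F differentiable (at x)"
    and svd: "is_svd (Jac F x) (\<sigma> x) (u x) (v x)"
    and lip: "L-lipschitz_on UNIV (Jac F)"
    and regular: "regular_smooth h F \<alpha> \<beta> zs"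
    and aligned: "strongly_aligned F \<sigma> u zs \<delta> s"
begin

abbreviation gap :: "'e \<Rightarrow> real" where "gap x \<equiv> h (F x) - min_value h (range F)"
abbreviation err :: "'e \<Rightarrow> 'y" where "err x \<equiv> F x - zs"
abbreviation proj_grad :: "'e \<Rightarrow> 'y" where "proj_grad x \<equiv> range_proj F x (grad h (F x))"
abbreviation damped_grad :: "'e \<Rightarrow> real \<Rightarrow> 'y" where
  "damped_grad x l \<equiv> damped_proj F x l (grad h (F x))"
abbreviation dir :: "'e \<Rightarrow> real \<Rightarrow> 'e" where
  "dir x l \<equiv> damped_inv (Jac F x) l (adjoint (blinfun_apply (Jac F x)) (grad h (F x)))"

lemma pos: "0 < \<alpha>" "0 < \<beta>" "0 < s" and L_nonneg: "0 \<le> L"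
  using regular aligned lip
  by (auto simp: regular_smooth_def strongly_aligned_def lipschitz_on_def)

lemma minimizers_eq: "minimizers h (range F) = {zs}"
  using regular by (simp add: regular_smooth_def)

lemma gap_growth: "\<alpha> / 2 * (norm (err x))\<^sup>2 \<le> gap x"
  using regular by (simp add: regular_smooth_def)

lemma gap_nonneg: "0 \<le> gap x"
  using gap_growth[of x] pos by (smt (verit) mult_nonneg_nonneg zero_le_power2 divide_pos_pos)

lemma norm_proj_grad_le: "norm (proj_grad x) \<le> \<beta> * norm (err x)"
  using regular unfolding regular_smooth_def by blast

lemma proj_grad_gap: "(norm (proj_grad x))\<^sup>2 \<le> 2 * \<beta> * gap x"
proof -
  have "1 / (2 * \<beta>) * (norm (proj_grad x))\<^sup>2 \<le> gap x"
    using regular unfolding regular_smooth_def by blast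
  then show ?thesis using pos by (simp add: pos_divide_le_eq mult.commute)
qed

lemma gap_le_inner: "gap x \<le> grad h (F x) \<bullet> err x"
proof -
  have zs: "zs \<in> range F" "\<And>w. w \<in> range F \<Longrightarrow> h zs \<le> h w"
    using minimizers_eq by (auto simp: minimizers_def)
  have "min_value h (range F) = h zs"
    unfolding min_value_def using zs by (intro cInf_eq_minimum) auto
  moreover have "convex_on UNIV h" using regular by (simp add: regular_smooth_def)
  ultimately show ?thesis
    using convex_gradient_inequality[OF _ h_diff, of "F x" zs] by simp
qed

text \<open>The damped gradient lies in the range of the Jacobian, so in the energy identity the
gradient may be replaced by its projection; only the projected gradient is bounded by the
regularity hypothesis.\<close>

lemma damped_grad_energy:
  assumes "0 < l"
  shows "(norm (damped_grad x l))\<^sup>2 + l * (norm (dir x l))\<^sup>2 = damped_grad x l \<bullet> proj_grad x"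
proof -
  have "linear (blinfun_apply (Jac F x))"
    using blinfun.bounded_linear_right bounded_linear.linear by blast
  then have "subspace (range (blinfun_apply (Jac F x)))"
    by (simp add: linear_subspace_image)
  then have "damped_grad x l \<bullet> proj_grad x = damped_grad x l \<bullet> grad h (F x)"
    unfolding range_proj_def by (rule inner_orth_proj) (simp add: damped_proj_def)
  then show ?thesis using damped_proj_energy[OF assms, of F x "grad h (F x)"] by simp
qed

text \<open>Writing \<open>p\<close>, \<open>r\<close> for the norms of the damped and the projected gradient, the
energy identity and Cauchy--Schwarz bound \<open>l\<close> times the squared parameter step by \<open>p r - p\<^sup>2\<close>,
and completing the square controls this by \<open>r\<^sup>2\<close>.  The first bound treats parameter step and damped gradient jointly: it
gives the factor \<open>1 / 3\<close>, where adding the separate bounds would give \<open>1 / 2\<close>.  The contraction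
factor for constant steps depends on this gain.\<close>

lemma damped_grad_energy_le:
  assumes "0 < l"
  shows "l * (norm (dir x l))\<^sup>2 + (norm (damped_grad x l))\<^sup>2 / 4 \<le> (norm (proj_grad x))\<^sup>2 / 3"
    and "l * (norm (dir x l))\<^sup>2 \<le> (norm (proj_grad x))\<^sup>2 / 4"
    and "norm (damped_grad x l) \<le> norm (proj_grad x)"
proof -
  define p where "p = norm (damped_grad x l)"
  define r where "r = norm (proj_grad x)"
  define W where "W = l * (norm (dir x l))\<^sup>2"
  have W: "0 \<le> W" using assms by (simp add: W_def)
  have en: "p\<^sup>2 + W \<le> p * r"
    unfolding p_def r_def W_def using damped_grad_energy[OF assms, of x] norm_cauchy_schwarz by metis
  have "0 \<le> (3 * p / 2 - r)\<^sup>2" "0 \<le> (2 * p - r)\<^sup>2" by simp_all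
  then show "W + p\<^sup>2 / 4 \<le> r\<^sup>2 / 3" "W \<le> r\<^sup>2 / 4"
    using en by (simp_all add: power2_eq_square algebra_simps)
  have "p * p \<le> p * r" using en W by (simp add: power2_eq_square)
  then show "p \<le> r" unfolding p_def r_def
    by (smt (verit) mult_le_cancel_left_pos norm_ge_zero)
qed

text \<open>This is the point where alignment enters.  Undamped, convexity would give correlation at
least the gap.  Damping costs the inner product of the gradient with the residual of the error, and
by regularity and alignment this is at most \<open>\<alpha> / 8\<close> times the squared error: half of it for the
poorly aligned tail, half for the damping of the well-conditioned directions.  Quadratic growth
turns that into a quarter of the gap.\<close>

lemma damped_grad_correlation:
  assumes l: "0 < l" "l \<le> s * \<alpha> / (16 * \<beta>)" and near: "norm (err x) \<le> \<delta> (\<alpha> / (16 * \<beta>))"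
  shows "3 / 4 * gap x \<le> damped_grad x l \<bullet> err x"
proof -
  let ?r = "err x - damped_proj F x l (err x)" and ?d = "norm (err x)"
  have "norm ?r \<le> (\<alpha> / (16 * \<beta>) + l / s) * ?d"
    using aligned_residual[where \<sigma> = \<sigma> and u = u and v = v and x = x, OF svd aligned, of "\<alpha> / (16 * \<beta>)" l] near l pos by simp
  also have "\<dots> \<le> (\<alpha> / (8 * \<beta>)) * ?d"
  proof (rule mult_right_mono)
    have "l / s \<le> \<alpha> / (16 * \<beta>)" using l pos by (simp add: field_simps)
    then show "\<alpha> / (16 * \<beta>) + l / s \<le> \<alpha> / (8 * \<beta>)" by simp
  qed simp
  finally have r: "norm ?r \<le> \<alpha> / (8 * \<beta>) * ?d" .
  have "\<bar>grad h (F x) \<bullet> ?r\<bar> \<le> \<beta> * ?d * norm ?r"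
    using regular l unfolding regular_smooth_def by blast
  also have "\<dots> \<le> \<beta> * ?d * (\<alpha> / (8 * \<beta>) * ?d)"
    using r pos by (intro mult_left_mono) auto
  also have "\<dots> = (\<alpha> / 2 * ?d\<^sup>2) / 4" using pos by (simp add: field_simps power2_eq_square)
  also have "\<dots> \<le> gap x / 4" using gap_growth[of x] by simp
  finally have "\<bar>grad h (F x) \<bullet> ?r\<bar> \<le> gap x / 4" .
  moreover have "damped_grad x l \<bullet> err x = grad h (F x) \<bullet> err x - grad h (F x) \<bullet> ?r"
    unfolding damped_proj_symmetric[OF l(1)] inner_diff_right[symmetric] by simp
  ultimately show ?thesis
    using gap_le_inner[of x] by (simp only: abs_le_iff) argo
qed

text \<open>The hypothesis \<open>short\<close> says that the linearized step does not increase the error.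
Therefore the linearization error, which is at most \<open>e\<close>, can be weighted by the old error.\<close>

lemma step_expansion:
  fixes x :: 'e and l \<gamma> :: real
  defines "e \<equiv> L / 2 * \<gamma>\<^sup>2 * (norm (dir x l))\<^sup>2"
  assumes \<gamma>: "0 \<le> \<gamma>" and short: "\<gamma> * (norm (damped_grad x l))\<^sup>2 \<le> 2 * (damped_grad x l \<bullet> err x)"
  shows "(norm (err (x - \<gamma> *\<^sub>R dir x l)))\<^sup>2
     \<le> (norm (err x))\<^sup>2 - 2 * \<gamma> * (damped_grad x l \<bullet> err x) + \<gamma>\<^sup>2 * (norm (damped_grad x l))\<^sup>2
        + 2 * norm (err x) * e + e\<^sup>2"
proof -
  let ?p = "damped_grad x l"
  define b where "b = err x - \<gamma> *\<^sub>R ?p"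
  define E where "E = err (x - \<gamma> *\<^sub>R dir x l) - b"
  have "blinfun_apply (Jac F x) (- (\<gamma> *\<^sub>R dir x l)) = - (\<gamma> *\<^sub>R ?p)"
    by (simp add: damped_proj_def blinfun.scaleR_right blinfun.minus_right)
  then have "norm E \<le> L / 2 * (norm (\<gamma> *\<^sub>R dir x l))\<^sup>2"
    using linearization_error[OF F_diff lip, of x "- (\<gamma> *\<^sub>R dir x l)"]
    by (simp add: E_def b_def algebra_simps)
  then have E: "norm E \<le> e" by (simp add: e_def power_mult_distrib)
  have bsq: "(norm b)\<^sup>2 = (norm (err x))\<^sup>2 - 2 * \<gamma> * (?p \<bullet> err x) + \<gamma>\<^sup>2 * (norm ?p)\<^sup>2"
  proof -
    have "(norm (y - \<gamma> *\<^sub>R p))\<^sup>2 = (norm y)\<^sup>2 - 2 * \<gamma> * (p \<bullet> y) + \<gamma>\<^sup>2 * (norm p)\<^sup>2" for y p :: 'y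
      unfolding power2_norm_eq_inner
      by (simp add: inner_diff_left inner_diff_right inner_commute power2_eq_square algebra_simps)
    then show ?thesis unfolding b_def .
  qed
  have "\<gamma> * (\<gamma> * (norm ?p)\<^sup>2) \<le> \<gamma> * (2 * (?p \<bullet> err x))" using short \<gamma> by (rule mult_left_mono)
  then have "(norm b)\<^sup>2 \<le> (norm (err x))\<^sup>2" unfolding bsq by (simp add: power2_eq_square mult_ac)
  then have b: "norm b \<le> norm (err x)" by (rule power2_le_imp_le) simp
  have "(norm (b + E))\<^sup>2 \<le> (norm b + norm E)\<^sup>2"
    by (intro power_mono norm_triangle_ineq) simp
  also have "\<dots> = (norm b)\<^sup>2 + 2 * norm b * norm E + (norm E)\<^sup>2" by (simp add: power2_sum)
  also have "\<dots> \<le> (norm b)\<^sup>2 + 2 * norm (err x) * e + e\<^sup>2"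
    using b E by (intro add_mono mult_mono power_mono) auto
  finally show ?thesis unfolding bsq E_def by simp
qed

section \<open>Contraction under Polyak and constant steps\<close>

text \<open>Put \<open>Q = gap\<^sup>2 / r\<^sup>2\<close>, with \<open>r\<close> the norm of the projected gradient.  The Polyak step turns
every term of the expansion into a multiple of \<open>\<gamma> Q\<close>: the decrease is at least \<open>3/2\<close>, the square
of the damped gradient costs at most \<open>1\<close>, and since the damping dominates \<open>L \<gamma>\<close> times the error,
the linearization error costs \<open>1/4 + 1/36\<close>.  What remains is \<open>2/9\<close>, and the gap bounds of the
regularity hypothesis compare \<open>Q\<close> with the squared error.  Positivity of the step size
excludes a vanishing gap or projected gradient.\<close>

lemma Polyak_step_contraction:
  assumes \<gamma>: "0 < \<gamma>" "\<gamma> \<le> 1" "\<gamma> * L \<le> C" and C: "0 < C" "C * norm (err x) \<le> l"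
    and l: "0 < l" "l \<le> s * \<alpha> / (16 * \<beta>)" and near: "norm (err x) \<le> \<delta> (\<alpha> / (16 * \<beta>))"
    and g: "g = \<gamma> * (gap x / (norm (proj_grad x))\<^sup>2)" and g_pos: "0 < g"
  shows "(norm (err (x - g *\<^sub>R dir x l)))\<^sup>2 \<le> (1 - \<gamma> * \<alpha> / (32 * \<beta>)) * (norm (err x))\<^sup>2"
proof -
  define r where "r = norm (proj_grad x)"
  define p where "p = norm (damped_grad x l)"
  define d where "d = norm (err x)"
  define c where "c = damped_grad x l \<bullet> err x"
  define W where "W = (norm (dir x l))\<^sup>2"
  define e where "e = L / 2 * g\<^sup>2 * W"
  define Q where "Q = (gap x)\<^sup>2 / r\<^sup>2"
  have nonneg: "0 \<le> p" "0 \<le> d" "0 \<le> W" "0 \<le> Q" "0 \<le> e"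
    using L_nonneg by (simp_all add: p_def d_def W_def Q_def e_def)
  have "gap x \<noteq> 0" and "r \<noteq> 0" using g g_pos by (auto simp: r_def)
  then have gap: "0 < gap x" and r: "0 < r"
    using gap_nonneg[of x] by (simp_all add: r_def order_less_le)
  have pr: "p \<le> r" and Wr: "l * W \<le> r\<^sup>2 / 4"
    using damped_grad_energy_le[OF l(1), of x] by (simp_all add: p_def r_def W_def)
  have corr: "3 / 4 * gap x \<le> c" using damped_grad_correlation[OF l near] by (simp add: c_def)
  have gg: "g * gap x = \<gamma> * Q" and g2r: "g\<^sup>2 * r\<^sup>2 = \<gamma>\<^sup>2 * Q" and gr: "g * r\<^sup>2 = \<gamma> * gap x"
    using r unfolding g r_def[symmetric] Q_def by (simp_all add: field_simps power2_eq_square)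
  have p2: "p\<^sup>2 \<le> r\<^sup>2" using pr nonneg by (simp add: power_mono)
  have "c \<le> p * d" unfolding c_def p_def d_def by (rule norm_cauchy_schwarz)
  also have "\<dots> \<le> r * d" using pr nonneg by (simp add: mult_right_mono)
  finally have crd: "3 / 4 * gap x \<le> r * d" using corr by simp
  then have "0 < r * d" using gap by simp
  then have d: "0 < d" using r by (simp add: zero_less_mult_iff)
  have Qd: "Q \<le> 16 / 9 * d\<^sup>2"
  proof -
    have "(3 / 4 * gap x)\<^sup>2 \<le> (r * d)\<^sup>2" using crd gap by (intro power_mono) auto
    then show ?thesis using r by (simp add: Q_def power_mult_distrib field_simps power2_eq_square)
  qed
  have "g * p\<^sup>2 \<le> g * r\<^sup>2" using p2 g_pos by simp
  also have "\<dots> \<le> gap x" unfolding gr using \<gamma> gap by simp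
  finally have short: "g * p\<^sup>2 \<le> 2 * c" using corr gap by simp
  \<comment> \<open>The damping is at least \<open>C\<close> times the error, which cancels the factor \<open>d\<close> of the cross term.\<close>
  have de: "d * e \<le> \<gamma> * Q / 8"
  proof -
    have "C * (d * e) \<le> l * e"
      using C(2) nonneg by (simp add: d_def mult_right_mono flip: mult.assoc)
    also have "\<dots> = L / 2 * g\<^sup>2 * (l * W)" by (simp add: e_def)
    also have "\<dots> \<le> L / 2 * g\<^sup>2 * (r\<^sup>2 / 4)" using Wr L_nonneg by (intro mult_left_mono) auto
    also have "\<dots> = L / 8 * (g\<^sup>2 * r\<^sup>2)" by simp
    also have "\<dots> = (\<gamma> * L) * (\<gamma> * Q / 8)" unfolding g2r by (simp add: power2_eq_square)
    also have "\<dots> \<le> C * (\<gamma> * Q / 8)" using \<gamma> nonneg by (intro mult_right_mono) auto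
    finally show ?thesis using C by simp
  qed
  have e2: "e\<^sup>2 \<le> \<gamma> * Q / 36"
  proof -
    have "d\<^sup>2 * e\<^sup>2 \<le> (\<gamma> * Q / 8)\<^sup>2"
      using de nonneg by (simp add: power_mono flip: power_mult_distrib)
    also have "\<dots> = \<gamma> * (\<gamma> * Q) * (Q / 64)" by (simp add: power2_eq_square)
    also have "\<dots> \<le> 1 * (\<gamma> * Q) * ((16 / 9 * d\<^sup>2) / 64)"
      using \<gamma> nonneg Qd by (intro mult_mono) auto
    also have "\<dots> = d\<^sup>2 * (\<gamma> * Q / 36)" by simp
    finally show ?thesis using d by simp
  qed
  have "(norm (err (x - g *\<^sub>R dir x l)))\<^sup>2 \<le> d\<^sup>2 - 2 * g * c + g\<^sup>2 * p\<^sup>2 + 2 * d * e + e\<^sup>2"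
    using step_expansion[of g x l] g_pos short by (simp add: d_def c_def p_def e_def W_def)
  also have "\<dots> \<le> d\<^sup>2 - 3 / 2 * (\<gamma> * Q) + \<gamma> * Q + \<gamma> * Q / 4 + \<gamma> * Q / 36"
  proof -
    have "g * (3 / 4 * gap x) \<le> g * c" using corr g_pos by (intro mult_left_mono) auto
    then have "3 / 2 * (\<gamma> * Q) \<le> 2 * g * c" using gg by (simp add: algebra_simps)
    moreover have "g\<^sup>2 * p\<^sup>2 \<le> \<gamma> * Q"
    proof -
      have "g\<^sup>2 * p\<^sup>2 \<le> g\<^sup>2 * r\<^sup>2" using p2 by (intro mult_left_mono) auto
      also have "\<dots> = \<gamma> * (\<gamma> * Q)" unfolding g2r by (simp add: power2_eq_square)
      also have "\<dots> \<le> 1 * (\<gamma> * Q)" using \<gamma> nonneg by (intro mult_right_mono) auto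
      finally show ?thesis by simp
    qed
    ultimately show ?thesis using de e2 by linarith
  qed
  also have "\<dots> = d\<^sup>2 - 2 / 9 * (\<gamma> * Q)" by simp
  also have "\<dots> \<le> d\<^sup>2 - 2 / 9 * (\<gamma> * (\<alpha> * d\<^sup>2 / (4 * \<beta>)))"
  proof -
    have "\<alpha> * d\<^sup>2 / (4 * \<beta>) = (\<alpha> / 2 * d\<^sup>2) / (2 * \<beta>)" by simp
    also have "\<dots> \<le> gap x / (2 * \<beta>)"
      using gap_growth[of x] pos by (intro divide_right_mono) (auto simp: d_def)
    also have "\<dots> \<le> Q"
    proof -
      have "r\<^sup>2 * gap x \<le> (2 * \<beta> * gap x) * gap x"
        using proj_grad_gap[of x] gap by (intro mult_right_mono) (auto simp: r_def)
      then show ?thesis using r pos by (simp add: Q_def field_simps power2_eq_square)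
    qed
    finally have "\<gamma> * (\<alpha> * d\<^sup>2 / (4 * \<beta>)) \<le> \<gamma> * Q" using \<gamma> by (intro mult_left_mono) auto
    then show ?thesis by linarith
  qed
  also have "\<dots> = d\<^sup>2 - (\<gamma> * \<alpha> * d\<^sup>2 / \<beta>) / 18" by (simp add: mult_ac)
  also have "\<dots> \<le> d\<^sup>2 - (\<gamma> * \<alpha> * d\<^sup>2 / \<beta>) / 32"
    using \<gamma> pos by (simp add: field_simps)
  also have "\<dots> = (1 - \<gamma> * \<alpha> / (32 * \<beta>)) * d\<^sup>2" by (simp add: algebra_simps)
  finally show ?thesis by (simp add: d_def)
qed

text \<open>In multiples of \<open>\<gamma> gap\<close>, the decrease is at least \<open>3/2\<close>.  The square of the
damped gradient and the cross term of the linearization error cost \<open>1/3\<close> together, by the joint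
energy bound, and the squared linearization error is negligible.  A net decrease of at least
\<open>\<gamma> gap\<close> remains, which by quadratic growth is the asserted factor without any loss.\<close>

lemma constant_step_contraction:
  assumes \<gamma>: "0 < \<gamma>" "\<gamma> * \<beta> \<le> 1 / 8" and curv: "L * norm (err x) * (\<gamma> * \<beta>) \<le> l / 2"
    and l: "0 < l" "l \<le> s * \<alpha> / (16 * \<beta>)" and near: "norm (err x) \<le> \<delta> (\<alpha> / (16 * \<beta>))"
  shows "(norm (err (x - \<gamma> *\<^sub>R dir x l)))\<^sup>2 \<le> (1 - \<gamma> * \<alpha> / 2) * (norm (err x))\<^sup>2"
proof -
  define r where "r = norm (proj_grad x)"
  define p where "p = norm (damped_grad x l)"
  define d where "d = norm (err x)"
  define c where "c = damped_grad x l \<bullet> err x"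
  define W where "W = (norm (dir x l))\<^sup>2"
  define e where "e = L / 2 * \<gamma>\<^sup>2 * W"
  have nonneg: "0 \<le> p" "0 \<le> d" "0 \<le> W" "0 \<le> r" "0 \<le> e"
    using L_nonneg by (simp_all add: p_def d_def W_def r_def e_def)
  have gap: "0 \<le> gap x" by (rule gap_nonneg)
  have joint: "l * W + p\<^sup>2 / 4 \<le> r\<^sup>2 / 3" and Wr: "l * W \<le> r\<^sup>2 / 4" and pr: "p \<le> r"
    using damped_grad_energy_le[OF l(1), of x] by (simp_all add: p_def r_def W_def)
  have rgap: "r\<^sup>2 \<le> 2 * \<beta> * gap x" and rd: "r \<le> \<beta> * d"
    using proj_grad_gap norm_proj_grad_le by (simp_all add: r_def d_def)
  have corr: "3 / 4 * gap x \<le> c" using damped_grad_correlation[OF l near] by (simp add: c_def)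
  have short: "\<gamma> * p\<^sup>2 \<le> 2 * c"
  proof -
    have "\<gamma> * p\<^sup>2 \<le> \<gamma> * r\<^sup>2" using pr nonneg \<gamma> by (simp add: power_mono)
    also have "\<dots> \<le> \<gamma> * (2 * \<beta> * gap x)" using rgap \<gamma> by simp
    also have "\<dots> = 2 * (\<gamma> * \<beta>) * gap x" by simp
    also have "\<dots> \<le> 2 * (1 / 8) * gap x" using \<gamma> gap by (intro mult_right_mono) auto
    finally show ?thesis using corr gap by simp
  qed
  have second_order: "2 * d * e + \<gamma>\<^sup>2 * p\<^sup>2 \<le> \<gamma> * gap x / 3"
  proof -
    have "\<beta> * (2 * d * e) = \<gamma> * (L * d * (\<gamma> * \<beta>)) * W" by (simp add: e_def power2_eq_square)
    also have "\<dots> \<le> \<gamma> * (l / 2) * W"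
      using curv \<gamma> nonneg by (intro mult_right_mono mult_left_mono) (auto simp: d_def)
    finally have 1: "\<beta> * (2 * d * e) \<le> \<gamma> / 2 * (l * W)" by simp
    have "\<beta> * (\<gamma>\<^sup>2 * p\<^sup>2) = (\<gamma> * \<beta>) * (\<gamma> * p\<^sup>2)" by (simp add: power2_eq_square)
    also have "\<dots> \<le> 1 / 8 * (\<gamma> * p\<^sup>2)" using \<gamma> by (intro mult_right_mono) auto
    finally have 2: "\<beta> * (\<gamma>\<^sup>2 * p\<^sup>2) \<le> \<gamma> / 2 * (p\<^sup>2 / 4)" by simp
    have "\<beta> * (2 * d * e + \<gamma>\<^sup>2 * p\<^sup>2) \<le> \<gamma> / 2 * (l * W + p\<^sup>2 / 4)"
      using 1 2 by (simp add: distrib_left)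
    also have "\<dots> \<le> \<gamma> / 2 * (2 * \<beta> * gap x / 3)"
      using joint rgap \<gamma> by (intro mult_left_mono) auto
    also have "\<dots> = \<beta> * (\<gamma> * gap x / 3)" by simp
    finally show ?thesis using pos by simp
  qed
  \<comment> \<open>One factor \<open>d\<close> of the bound on the gradient is spent on \<open>curv\<close>; the other one makes the
     squared linearization error a small multiple of the cross term.\<close>
  have "e \<le> d / 128"
  proof -
    have "l * e = L / 2 * \<gamma>\<^sup>2 * (l * W)" by (simp add: e_def)
    also have "\<dots> \<le> L / 2 * \<gamma>\<^sup>2 * ((\<beta> * d)\<^sup>2 / 4)"
    proof (intro mult_left_mono)
      have "r\<^sup>2 \<le> (\<beta> * d)\<^sup>2" using rd nonneg by (intro power_mono)
      then show "l * W \<le> (\<beta> * d)\<^sup>2 / 4" using Wr by simp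
    qed (use L_nonneg in auto)
    also have "\<dots> = (L * d * (\<gamma> * \<beta>)) * (\<gamma> * \<beta>) * d / 8" by (simp add: power2_eq_square)
    also have "\<dots> \<le> (l / 2) * (1 / 8) * d / 8"
      using curv \<gamma> nonneg L_nonneg pos l
      by (intro divide_right_mono mult_right_mono mult_mono) (auto simp: d_def)
    also have "\<dots> = l * (d / 128)" by simp
    finally show ?thesis using l by simp
  qed
  then have "e * e \<le> d / 128 * e" using nonneg by (intro mult_right_mono)
  then have "e\<^sup>2 \<le> d * e / 128" by (simp add: power2_eq_square)
  moreover have "0 \<le> \<gamma>\<^sup>2 * p\<^sup>2" by simp
  ultimately have e2: "e\<^sup>2 \<le> \<gamma> * gap x / 768" using second_order by linarith
  have "(norm (err (x - \<gamma> *\<^sub>R dir x l)))\<^sup>2 \<le> d\<^sup>2 - 2 * \<gamma> * c + \<gamma>\<^sup>2 * p\<^sup>2 + 2 * d * e + e\<^sup>2"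
    using step_expansion[of \<gamma> x l] \<gamma> short by (simp add: d_def c_def p_def e_def W_def)
  also have "\<dots> \<le> d\<^sup>2 - \<gamma> * gap x"
  proof -
    have "\<gamma> * (3 / 4 * gap x) \<le> \<gamma> * c" using corr \<gamma> by (intro mult_left_mono) auto
    then have "3 / 2 * (\<gamma> * gap x) \<le> 2 * \<gamma> * c" by (simp add: algebra_simps)
    moreover have "0 \<le> \<gamma> * gap x" using \<gamma> gap by simp
    ultimately show ?thesis using second_order e2 by linarith
  qed
  also have "\<dots> \<le> d\<^sup>2 - \<gamma> * (\<alpha> / 2 * d\<^sup>2)"
    using gap_growth[of x] \<gamma> by (simp add: d_def mult_left_mono)
  finally show ?thesis by (simp add: d_def algebra_simps)
qed

text \<open>A contraction keeps the iterates inside the ball where alignment and the bound on the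
damping hold, so it can be iterated.  Iterating needs a nonnegative contraction factor; this follows from
the first step, because positive damping means that the start is not yet optimal.\<close>

lemma Polyak_convergence:
  assumes lmm: "LMM_sequence h F x0 \<gamma>s \<mu>s x"
    and conf: "Polyak_config h F \<gamma> Cl Cu \<gamma>s \<mu>s x"
    and \<gamma>: "\<gamma> \<le> 1" "\<gamma> * L \<le> Cl"
    and near: "norm (err x0) \<le> \<delta> (\<alpha> / (16 * \<beta>))"
    and small: "norm (err x0) \<le> s * \<alpha> / (16 * Cu * \<beta>)"
  shows "(norm (err (x k)))\<^sup>2 \<le> (1 - \<gamma> * \<alpha> / (32 * \<beta>)) ^ k * (norm (err x0))\<^sup>2"
proof -
  let ?c = "1 - \<gamma> * \<alpha> / (32 * \<beta>)"
  have \<gamma>_pos: "0 < \<gamma>" and Cl: "0 < Cl" and Cu: "Cl \<le> Cu"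
    using conf by (simp_all add: Polyak_config_def)
  have damp: "Cl * norm (err (x k)) \<le> \<mu>s k" "\<mu>s k \<le> Cu * norm (err (x k))" for k
    using conf by (simp_all add: Polyak_config_def minimizers_eq dist_norm)
  have \<gamma>s: "0 < \<gamma>s k" "0 < \<mu>s k" for k using lmm by (simp_all add: LMM_sequence_def)
  have \<gamma>s_eq: "\<gamma>s k = \<gamma> * (gap (x k) / (norm (proj_grad (x k)))\<^sup>2)" for k
    using conf by (simp add: Polyak_config_def)
  have x0: "x 0 = x0" and x_Suc: "x (Suc k) = x k - \<gamma>s k *\<^sub>R dir (x k) (\<mu>s k)" for k
    using lmm by (simp_all add: LMM_sequence_def)
  have step: "(norm (err (x (Suc k))))\<^sup>2 \<le> ?c * (norm (err (x k)))\<^sup>2"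
    if le: "norm (err (x k)) \<le> norm (err x0)" for k
    unfolding x_Suc
  proof (rule Polyak_step_contraction[OF \<gamma>_pos \<gamma> Cl damp(1) \<gamma>s(2) _ _ \<gamma>s_eq \<gamma>s(1)])
    have "\<mu>s k \<le> Cu * norm (err (x k))" by (rule damp)
    also have "\<dots> \<le> Cu * (s * \<alpha> / (16 * Cu * \<beta>))"
      using le small Cl Cu by (intro mult_left_mono) auto
    also have "\<dots> = s * \<alpha> / (16 * \<beta>)" using Cl Cu by simp
    finally show "\<mu>s k \<le> s * \<alpha> / (16 * \<beta>)" .
    show "norm (err (x k)) \<le> \<delta> (\<alpha> / (16 * \<beta>))" using le near by simp
  qed
  have c_le: "?c \<le> 1" using \<gamma>_pos pos by simp
  have c_nonneg: "0 \<le> ?c"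
  proof (rule ccontr)
    assume "\<not> 0 \<le> ?c"
    have "0 < norm (err (x 0))"
      using damp(2)[of 0] \<gamma>s(2)[of 0] by (cases "norm (err (x 0)) = 0") auto
    then have "?c * (norm (err (x 0)))\<^sup>2 < 0" using \<open>\<not> 0 \<le> ?c\<close>
      by (intro mult_neg_pos) auto
    then show False using step[of 0] x0 by (smt (verit) zero_le_power2)
  qed
  show ?thesis
  proof (induction k)
    case 0
    show ?case by (simp add: x0)
  next
    case (Suc k)
    have "?c ^ k * (norm (err x0))\<^sup>2 \<le> 1 * (norm (err x0))\<^sup>2"
      using c_nonneg c_le by (intro mult_right_mono power_le_one) auto
    then have "(norm (err (x k)))\<^sup>2 \<le> (norm (err x0))\<^sup>2" using Suc by linarith
    then have "norm (err (x k)) \<le> norm (err x0)" by (rule power2_le_imp_le[OF _ norm_ge_zero])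
    then have "(norm (err (x (Suc k))))\<^sup>2 \<le> ?c * (norm (err (x k)))\<^sup>2" by (rule step)
    also have "\<dots> \<le> ?c * (?c ^ k * (norm (err x0))\<^sup>2)"
      using Suc c_nonneg by (rule mult_left_mono)
    finally show ?case by (simp add: mult.assoc)
  qed
qed

text \<open>The damping \<open>\<mu> q\<^sup>k\<close> shrinks at the same rate as the guaranteed bound on the error, so the
ratio that limits the step size stays constant along the iteration.\<close>

lemma constant_step_convergence:
  assumes lmm: "LMM_sequence h F x0 (\<lambda>k. \<gamma>) (\<lambda>k. \<mu> * q ^ k) x"
    and \<gamma>: "0 < \<gamma>" "\<gamma> * \<beta> \<le> 1 / 8" "L * \<delta> (\<alpha> / (16 * \<beta>)) * (\<gamma> * \<beta>) \<le> \<mu> / 2"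
    and \<mu>: "0 < \<mu>" "\<mu> \<le> s * \<alpha> / (16 * \<beta>)" and q: "0 < q" "q < 1" "1 - \<gamma> * \<alpha> / 2 \<le> q\<^sup>2"
    and near: "norm (err x0) \<le> \<delta> (\<alpha> / (16 * \<beta>))"
  shows "norm (err (x k)) \<le> \<delta> (\<alpha> / (16 * \<beta>)) * q ^ k"
proof (induction k)
  case 0
  show ?case using lmm near by (simp add: LMM_sequence_def)
next
  case (Suc k)
  let ?M = "\<delta> (\<alpha> / (16 * \<beta>))"
  have qk: "0 < q ^ k" "q ^ k \<le> 1" using q by (simp_all add: power_le_one)
  have M: "0 < ?M" using aligned pos by (simp add: strongly_aligned_def)
  have "(norm (err (x k - \<gamma> *\<^sub>R dir (x k) (\<mu> * q ^ k))))\<^sup>2 \<le> (1 - \<gamma> * \<alpha> / 2) * (norm (err (x k)))\<^sup>2"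
  proof (rule constant_step_contraction[OF \<gamma>(1,2)])
    have "L * norm (err (x k)) * (\<gamma> * \<beta>) \<le> L * (?M * q ^ k) * (\<gamma> * \<beta>)"
      using Suc L_nonneg \<gamma> pos by (intro mult_right_mono mult_left_mono) auto
    also have "\<dots> = (L * ?M * (\<gamma> * \<beta>)) * q ^ k" by simp
    also have "\<dots> \<le> \<mu> / 2 * q ^ k" using \<gamma>(3) qk by (intro mult_right_mono) auto
    finally show "L * norm (err (x k)) * (\<gamma> * \<beta>) \<le> \<mu> * q ^ k / 2" by simp
    show "0 < \<mu> * q ^ k" using \<mu> qk by simp
    have "\<mu> * q ^ k \<le> \<mu> * 1" using \<mu> qk by (intro mult_left_mono) auto
    then show "\<mu> * q ^ k \<le> s * \<alpha> / (16 * \<beta>)" using \<mu>(2) by linarith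
    have "?M * q ^ k \<le> ?M * 1" using M qk by (intro mult_left_mono) auto
    then show "norm (err (x k)) \<le> ?M" using Suc by linarith
  qed
  also have "\<dots> \<le> q\<^sup>2 * (norm (err (x k)))\<^sup>2" using q by (intro mult_right_mono) auto
  also have "\<dots> = (q * norm (err (x k)))\<^sup>2" by (simp add: power_mult_distrib)
  finally have "norm (err (x k - \<gamma> *\<^sub>R dir (x k) (\<mu> * q ^ k))) \<le> q * norm (err (x k))"
    by (rule power2_le_imp_le) (use q in simp)
  then have "norm (err (x (Suc k))) \<le> q * norm (err (x k))"
    using lmm by (simp add: LMM_sequence_def)
  also have "\<dots> \<le> q * (?M * q ^ k)" using Suc q by simp
  finally show ?case by (simp add: mult_ac)
qed

end

section \<open>Linear convergence of the Levenberg--Morrison--Marquardt method\<close>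

theorem theorem4p6:
  fixes h :: "'y::euclidean_space \<Rightarrow> real"
    and F :: "'e::euclidean_space \<Rightarrow> 'y"
    and \<sigma> :: "'e \<Rightarrow> nat \<Rightarrow> real" and u :: "'e \<Rightarrow> nat \<Rightarrow> 'y" and v :: "'e \<Rightarrow> nat \<Rightarrow> 'e"
    and L \<alpha> \<beta> s :: real and \<delta> :: "real \<Rightarrow> real" and zs :: 'y and x0 :: 'e
  assumes "convex_on UNIV h" and "\<forall>z. h differentiable (at z)"
    and "cont_differentiable F"
    and "\<forall>x. is_svd (Jac F x) (\<sigma> x) (u x) (v x)"
    and "L-lipschitz_on UNIV (Jac F)"
    and "regular_smooth h F \<alpha> \<beta> zs"
    and "strongly_aligned F \<sigma> u zs \<delta> s"
    and "norm (F x0 - zs) \<le> \<delta> (\<alpha> / (16 * \<beta>))"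
  shows
    "(\<forall>\<gamma> C\<^sub>l\<^sub>b C\<^sub>u\<^sub>b \<gamma>s \<mu>s x.
        LMM_sequence h F x0 \<gamma>s \<mu>s x \<longrightarrow>
        Polyak_config h F \<gamma> C\<^sub>l\<^sub>b C\<^sub>u\<^sub>b \<gamma>s \<mu>s x \<longrightarrow>
        ereal \<gamma> \<le> min 1 (ereal C\<^sub>l\<^sub>b / ereal L) \<longrightarrow>
        norm (F x0 - zs) \<le> s * \<alpha> / (16 * C\<^sub>u\<^sub>b * \<beta>) \<longrightarrow>
        (\<forall>k. (norm (F (x k) - zs))\<^sup>2
              \<le> (1 - \<gamma> * \<alpha> / (32 * \<beta>)) ^ k * (norm (F x0 - zs))\<^sup>2))
     \<and>
     (\<forall>\<gamma> \<mu> q x. \<forall>M. M = \<delta> (\<alpha> / (16 * \<beta>)) \<longrightarrow>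
        LMM_sequence h F x0 (\<lambda>k. \<gamma>) (\<lambda>k. \<mu> * q ^ k) x \<longrightarrow>
        0 < \<gamma> \<longrightarrow> 0 < \<mu> \<longrightarrow> 0 < q \<longrightarrow> q < 1 \<longrightarrow>
        \<mu> \<le> s * \<alpha> / (16 * \<beta>) \<longrightarrow>
        \<gamma> \<le> 1 / \<beta> * (if L = 0 then 1 / 8
                        else Min {1 / 8, sqrt (32 * \<mu> / (L * M)), \<mu> / (2 * L * M)}) \<longrightarrow>
        q \<ge> max (sqrt (1 - \<gamma> * \<alpha> / 2)) (1 / sqrt 2) \<longrightarrow>
        (\<forall>k. norm (F (x k) - zs) \<le> M * q ^ k))"
proof -
  interpret aligned_composition h F \<sigma> u v L \<alpha> \<beta> s \<delta> zs
    using assms(2-7) unfolding cont_differentiable_def by unfold_locales blast+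
  show ?thesis
  proof (intro conjI allI impI)
    fix \<gamma> Cl Cu :: real and \<gamma>s \<mu>s :: "nat \<Rightarrow> real" and x :: "nat \<Rightarrow> 'e" and k :: nat
    assume lmm: "LMM_sequence h F x0 \<gamma>s \<mu>s x" and conf: "Polyak_config h F \<gamma> Cl Cu \<gamma>s \<mu>s x"
      and \<gamma>: "ereal \<gamma> \<le> min 1 (ereal Cl / ereal L)"
      and small: "norm (F x0 - zs) \<le> s * \<alpha> / (16 * Cu * \<beta>)"
    have Cl: "0 < Cl" using conf by (simp add: Polyak_config_def)
    have "\<gamma> * L \<le> Cl"
    proof (cases "L = 0")
      \<comment> \<open>The quotient is infinite here and does not restrict \<open>\<gamma>\<close>.\<close>
      case True
      then show ?thesis using Cl by simp
    next
      case False
      then have "\<gamma> \<le> Cl / L" using \<gamma> by simp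
      then show ?thesis using False L_nonneg by (simp add: field_simps)
    qed
    moreover have "\<gamma> \<le> 1" using \<gamma> by (simp add: one_ereal_def)
    ultimately show "(norm (F (x k) - zs))\<^sup>2 \<le> (1 - \<gamma> * \<alpha> / (32 * \<beta>)) ^ k * (norm (F x0 - zs))\<^sup>2"
      using Polyak_convergence[OF lmm conf _ _ assms(8) small] by simp
  next
    fix \<gamma> \<mu> q M :: real and x :: "nat \<Rightarrow> 'e" and k :: nat
    assume M: "M = \<delta> (\<alpha> / (16 * \<beta>))"
      and lmm: "LMM_sequence h F x0 (\<lambda>k. \<gamma>) (\<lambda>k. \<mu> * q ^ k) x"
      and \<gamma>0: "0 < \<gamma>" and \<mu>: "0 < \<mu>" "\<mu> \<le> s * \<alpha> / (16 * \<beta>)" and q: "0 < q" "q < 1"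
      and \<gamma>: "\<gamma> \<le> 1 / \<beta> * (if L = 0 then 1 / 8
                        else Min {1 / 8, sqrt (32 * \<mu> / (L * M)), \<mu> / (2 * L * M)})"
      and qb: "max (sqrt (1 - \<gamma> * \<alpha> / 2)) (1 / sqrt 2) \<le> q"
    have M_pos: "0 < M" using aligned pos by (simp add: M strongly_aligned_def)
    have \<gamma>\<beta>: "\<gamma> * \<beta> \<le> (if L = 0 then 1 / 8
                 else Min {1 / 8, sqrt (32 * \<mu> / (L * M)), \<mu> / (2 * L * M)})"
      using \<gamma> pos by (simp add: field_simps split del: if_split)
    then have eighth: "\<gamma> * \<beta> \<le> 1 / 8" by (auto split: if_splits)
    have curv: "L * M * (\<gamma> * \<beta>) \<le> \<mu> / 2"
    proof (cases "L = 0")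
      case True
      then show ?thesis using \<mu> by simp
    next
      case False
      then have "\<gamma> * \<beta> \<le> \<mu> / (2 * L * M)" using \<gamma>\<beta> by auto
      moreover have "0 < L" using False L_nonneg by simp
      ultimately show ?thesis using M_pos by (simp add: field_simps)
    qed
    have "1 - \<gamma> * \<alpha> / 2 \<le> q\<^sup>2"
      using qb by (intro sqrt_le_D) simp
    then show "norm (F (x k) - zs) \<le> M * q ^ k"
      using constant_step_convergence[OF lmm \<gamma>0 eighth _ \<mu> q _ assms(8)] curv by (simp add: M)
  qed
qed

end
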